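(* Let $G$ be a finite graph with adjacency matrix $A_G$. The map $\varphi\colon\hat\Pi(G)\to\mathcal P(G)$, $(w,\pi)\mapsto S_{(w,\pi)}:=D_wP_\pi P_\pi^{\mathsf T}D_w$, is a bijection. Moreover, let $w$ be a positive vector and let $\pi,\sigma$ be partitions of $V(G)$ that are both pseudo-equitable with respect to $w$; write $S_\pi$ (resp. $S_\sigma$) for the orthogonal projection onto the column space of $D_wP_\pi$ (resp. $D_wP_\sigma$). Then: (i) $\pi\le\sigma$ if and only if $S_\pi\succeq S_\sigma$, if and only if $\operatorname{rng}S_\pi\supseteq\operatorname{rng}S_\sigma$; (ii) $\pi\vee\sigma$ is pseudo-equitable with respect to $w$ and $S_{\pi\vee\sigma}$ is the orthogonal projection onto $\operatorname{rng}S_\pi\cap\operatorname{rng}S_\sigma$.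
   Context: $G$ is a finite simple undirected graph. For a partition $\pi=\{C_1,\dots,C_k\}$ of $V(G)$, $P_\pi$ is the $V(G)\times k$ $0/1$ matrix whose $r$-th column is the indicator of $C_r$. For $w\in\mathbb R^{V(G)}$ with all entries positive, $D_w=\operatorname{Diag}(w)$. A partition $\pi$ is pseudo-equitable with respect to $w$ if the column space of $D_wP_\pi$ is $A_G$-invariant. $\hat\Pi(G)$ is the set of pairs $(w,\pi)$ with $\pi$ pseudo-equitable with respect to $w>0$ and $w$ normalized in each cell (the restriction of $w$ to each cell of $\pi$ has Euclidean norm $1$); then $D_wP_\pi P_\pi^{\mathsf T}D_w$ is the orthogonal projection onto the column space of $D_wP_\pi$. $\mathcal P(G)$ is the set of real orthogonal projection matrices $S$ indexed by $V(G)$ with nonnegative entries such that some entrywise positive vector lies in the range of $S$ and $SA_G=A_GS$. $\pi\le\sigma$ means every cell of $\pi$ lies in a cell of $\sigma$; $\pi\vee\sigma$ is the finest partition coarser than both. $S\succeq T$ is the Loewner order ($S-T$ positive semidefinite); $\operatorname{rng}$ is the range (column space). *)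

theory Defs
  imports "HOL-Analysis.Analysis" "HOL-Library.Disjoint_Sets"
begin

(* A graph is given by its adjacency relation; its vertex set is the whole finite type. *)

definition simple_graph :: "('v::finite \<Rightarrow> 'v \<Rightarrow> bool) \<Rightarrow> bool"
  where "simple_graph E \<longleftrightarrow> symp E \<and> irreflp E"

definition adj_mat :: "('v::finite \<Rightarrow> 'v \<Rightarrow> bool) \<Rightarrow> real^'v^'v"
  where "adj_mat E = (\<chi> u v. if E u v then 1 else 0)"

definition diag_mat :: "real^'v \<Rightarrow> real^'v^'v::finite"
  where "diag_mat w = (\<chi> u v. if u = v then w $ v else 0)"

(* The columns are indexed by all subsets of the vertex set, and the column of a set that is not a
   cell of the partition is zero. Compared with the matrix having one column per cell, the extra
   zero columns change neither the column space nor the products P_pi P_pi^T. *)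

definition char_mat :: "'v set set \<Rightarrow> real^('v set)^'v::finite"
  where "char_mat \<pi> = (\<chi> v C. if C \<in> \<pi> \<and> v \<in> C then 1 else 0)"

definition rng :: "real^'n^'m \<Rightarrow> (real^'m) set"
  where "rng M = range ((*v) M)"

definition positive_vec :: "real^'v::finite \<Rightarrow> bool"
  where "positive_vec w \<longleftrightarrow> (\<forall>v. 0 < w $ v)"

definition pseudo_equitable :: "('v::finite \<Rightarrow> 'v \<Rightarrow> bool) \<Rightarrow> real^'v \<Rightarrow> 'v set set \<Rightarrow> bool"
  where "pseudo_equitable E w \<pi> \<longleftrightarrow> partition_on UNIV \<pi> \<and> positive_vec w \<and>
    (\<forall>x \<in> rng (diag_mat w ** char_mat \<pi>). adj_mat E *v x \<in> rng (diag_mat w ** char_mat \<pi>))"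

definition cell_normalized :: "real^'v::finite \<Rightarrow> 'v set set \<Rightarrow> bool"
  where "cell_normalized w \<pi> \<longleftrightarrow> (\<forall>C\<in>\<pi>. norm (\<chi> v. if v \<in> C then w $ v else 0) = 1)"

definition Pi_hat :: "('v::finite \<Rightarrow> 'v \<Rightarrow> bool) \<Rightarrow> ((real^'v) \<times> 'v set set) set"
  where "Pi_hat E = {(w, \<pi>). pseudo_equitable E w \<pi> \<and> cell_normalized w \<pi>}"

definition orthogonal_projection :: "real^'v^'v::finite \<Rightarrow> bool"
  where "orthogonal_projection S \<longleftrightarrow> S ** S = S \<and> transpose S = S"

definition proj_set :: "('v::finite \<Rightarrow> 'v \<Rightarrow> bool) \<Rightarrow> (real^'v^'v) set"
  where "proj_set E = {S. orthogonal_projection S \<and> (\<forall>u v. 0 \<le> S $ u $ v) \<and>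
    (\<exists>x \<in> rng S. positive_vec x) \<and> S ** adj_mat E = adj_mat E ** S}"

definition phi :: "(real^'v) \<times> 'v set set \<Rightarrow> real^'v^'v::finite"
  where "phi = (\<lambda>(w, \<pi>). diag_mat w ** char_mat \<pi> ** transpose (char_mat \<pi>) ** diag_mat w)"

definition orth_proj_onto :: "(real^'v) set \<Rightarrow> real^'v^'v::finite"
  where "orth_proj_onto U = (THE S. orthogonal_projection S \<and> rng S = U)"

definition proj_part :: "real^'v \<Rightarrow> 'v set set \<Rightarrow> real^'v^'v::finite"
  where "proj_part w \<pi> = orth_proj_onto (rng (diag_mat w ** char_mat \<pi>))"

definition psd :: "real^'v^'v::finite \<Rightarrow> bool"
  where "psd M \<longleftrightarrow> transpose M = M \<and> (\<forall>x. 0 \<le> x \<bullet> (M *v x))"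

definition loewner_ge :: "real^'v^'v::finite \<Rightarrow> real^'v^'v \<Rightarrow> bool"
  where "loewner_ge S T \<longleftrightarrow> psd (S - T)"

definition is_part_join :: "'v set set \<Rightarrow> 'v set set \<Rightarrow> 'v set set \<Rightarrow> bool"
  where "is_part_join \<pi> \<sigma> \<tau> \<longleftrightarrow> refines UNIV \<pi> \<tau> \<and> refines UNIV \<sigma> \<tau> \<and>
    (\<forall>\<rho>. refines UNIV \<pi> \<rho> \<and> refines UNIV \<sigma> \<rho> \<longrightarrow> refines UNIV \<tau> \<rho>)"

definition part_join :: "'v set set \<Rightarrow> 'v set set \<Rightarrow> 'v set set"
  where "part_join \<pi> \<sigma> = (THE \<tau>. is_part_join \<pi> \<sigma> \<tau>)"

lemma rng_eq_span_columns: "rng (M :: real^'n^'m) = span (columns M)"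
proof
  show "rng M \<subseteq> span (columns M)"
    unfolding rng_def
    by (clarsimp simp: matrix_mult_sum scalar_mult_eq_scaleR)
      (intro span_sum span_scale span_base, auto simp: columns_def)
  have sub: "subspace (rng M)"
    unfolding rng_def
    by (rule linear_subspace_image[OF matrix_vector_mul_linear subspace_UNIV])
  have "columns M \<subseteq> rng M"
  proof
    fix c assume "c \<in> columns M"
    then obtain i where "c = column i M" unfolding columns_def by blast
    then have "c = M *v axis i 1" by (simp only: matrix_vector_mult_basis)
    then show "c \<in> rng M" unfolding rng_def by blast
  qed
  then show "span (columns M) \<subseteq> rng M"
    by (rule span_minimal) (rule sub)
qed

(* The definite descriptions in orth_proj_onto and part_join are proper: *)

lemma ex1_orthogonal_projection:
  fixes U :: "(real^'v::finite) set"
  assumes "subspace U"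
  shows "\<exists>!S. orthogonal_projection S \<and> rng S = U"
proof (rule ex_ex1I)
  obtain B where B: "B \<subseteq> U" "pairwise orthogonal B" "\<And>x. x \<in> B \<Longrightarrow> norm x = 1"
    "independent B" "span B = U"
    using orthonormal_basis_subspace[OF assms] by metis
  have fin: "finite B" using B(4) independent_imp_finite by blast
  define f where "f x = (\<Sum>b\<in>B. (b \<bullet> x) *\<^sub>R b)" for x
  have lin: "linear f"
    unfolding f_def
    by (rule linearI) (simp_all add: inner_add_right scaleR_add_left sum.distrib scaleR_sum_right)
  have inU: "f x \<in> U" for x
    unfolding B(5)[symmetric] f_def by (intro span_sum span_scale span_base)
  have fb: "f b = b" if "b \<in> B" for b
  proof -
    have "(c \<bullet> b) *\<^sub>R c = (if c = b then b else 0)" if "c \<in> B" for c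
      using B(2,3) \<open>b \<in> B\<close> that unfolding pairwise_def orthogonal_def
      by (auto simp: dot_square_norm)
    then show ?thesis
      unfolding f_def using fin that by (simp cong: sum.cong)
  qed
  have fU: "f x = x" if "x \<in> U" for x
    using linear_eq_on[OF lin linear_ident, of x B] fb that B(5) by auto
  have sym: "x \<bullet> f y = f x \<bullet> y" for x y
    unfolding f_def by (simp add: inner_sum_left inner_sum_right inner_commute mult.commute)
  let ?S = "matrix f"
  have S: "?S *v x = f x" for x
    by (simp add: lin matrix_works)
  have "?S ** ?S = ?S"
    unfolding matrix_eq by (simp add: matrix_vector_mul_assoc[symmetric] S fU inU)
  moreover have "transpose ?S = ?S"
  proof -
    have "(transpose ?S *v x) \<bullet> y = (?S *v x) \<bullet> y" for x y
      by (metis S dot_lmul_matrix sym transpose_matrix_vector)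
    then show ?thesis
      unfolding matrix_eq by (metis vector_eq_rdot)
  qed
  moreover have "rng ?S = U"
    unfolding rng_def using inU fU by (auto simp: S image_iff) metis
  ultimately show "\<exists>S. orthogonal_projection S \<and> rng S = U"
    unfolding orthogonal_projection_def by blast
next
  fix S T :: "real^'v^'v"
  assume S: "orthogonal_projection S \<and> rng S = U" and T: "orthogonal_projection T \<and> rng T = U"
  have *: "M ** N = N" if "M ** M = M" "rng N \<subseteq> rng M" for M N :: "real^'v^'v"
  proof -
    have "M *v (N *v x) = N *v x" for x
    proof -
      have "N *v x \<in> rng M" using that(2) unfolding rng_def by blast
      then obtain y where "N *v x = M *v y" unfolding rng_def by blast
      then show ?thesis by (simp add: matrix_vector_mul_assoc that(1))
    qed
    then show ?thesis unfolding matrix_eq by (simp add: matrix_vector_mul_assoc[symmetric])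
  qed
  have "S ** T = T" "T ** S = S"
    using S T * unfolding orthogonal_projection_def by blast+
  then show "S = T"
    using S T unfolding orthogonal_projection_def by (metis matrix_transpose_mul)
qed

lemma orth_proj_onto:
  assumes "subspace U"
  shows "orthogonal_projection (orth_proj_onto U)" "rng (orth_proj_onto U) = U"
  using theI'[OF ex1_orthogonal_projection[OF assms]] unfolding orth_proj_onto_def by auto

lemma ex1_part_join:
  assumes "partition_on UNIV \<pi>" "partition_on UNIV \<sigma>"
  shows "\<exists>!\<tau>. is_part_join \<pi> \<sigma> \<tau>"
proof (rule ex_ex1I)
  let ?P = "{\<rho>. refines UNIV \<pi> \<rho> \<and> refines UNIV \<sigma> \<rho>}"
  have top: "{UNIV} \<in> ?P"
    using assms by (auto simp: refines_def partition_on_space)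
  have part: "partition_on UNIV \<rho>" if "\<rho> \<in> ?P" for \<rho>
    using that unfolding refines_def by blast
  have coarser: "refines UNIV \<alpha> (common_refinement ?P)"
    if \<alpha>: "partition_on UNIV \<alpha>" "\<And>\<rho>. \<rho> \<in> ?P \<Longrightarrow> refines UNIV \<alpha> \<rho>" for \<alpha>
    by (rule common_refinement_coarsest) (use part \<alpha> top in blast)+
  have "is_part_join \<pi> \<sigma> (common_refinement ?P)"
    unfolding is_part_join_def
  proof (intro conjI allI impI)
    show "refines UNIV \<pi> (common_refinement ?P)" "refines UNIV \<sigma> (common_refinement ?P)"
      by (rule coarser; use assms in blast)+
    show "refines UNIV (common_refinement ?P) \<rho>"
      if "refines UNIV \<pi> \<rho> \<and> refines UNIV \<sigma> \<rho>" for \<rho>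
      by (rule refines_common_refinement) (use part that in blast)+
  qed
  then show "\<exists>\<tau>. is_part_join \<pi> \<sigma> \<tau>" ..
next
  fix \<tau> \<tau>'
  assume "is_part_join \<pi> \<sigma> \<tau>" "is_part_join \<pi> \<sigma> \<tau>'"
  then show "\<tau> = \<tau>'"
    unfolding is_part_join_def by (intro refines_asym) auto
qed

lemma part_join:
  assumes "partition_on UNIV \<pi>" "partition_on UNIV \<sigma>"
  shows "is_part_join \<pi> \<sigma> (part_join \<pi> \<sigma>)"
  using theI'[OF ex1_part_join[OF assms]] unfolding part_join_def .

end

theory Submission
  imports Defs
begin

text \<open>
  The column space of \<open>D\<^sub>w P\<^sub>\<pi>\<close> consists of the vectors \<open>x\<close> for which \<open>x / w\<close> is constant on the
  cells of \<open>\<pi>\<close>. Restricting \<open>w\<close> to the cells of \<open>\<sigma>\<close> shows that the inclusion of these spaces encodes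
  refinement, and partitioning by the level sets of \<open>x / w\<close> shows that the join corresponds to the
  intersection.

  For surjectivity of \<open>\<phi>\<close>, let \<open>S\<close> be a nonnegative projection fixing the positive vector \<open>x\<close>. Then
  \<open>S\<^sub>u\<^sub>v > 0\<close> defines an equivalence relation, and a maximum argument applied to the ratio of a column
  of \<open>S\<close> to \<open>x\<close> shows that the block of \<open>S\<close> on each class is a multiple of \<open>x x\<^sup>T\<close>. Hence \<open>S\<close> is the
  image of \<open>w\<^sub>u = \<surd>S\<^sub>u\<^sub>u\<close> together with the partition into classes.
\<close>

section \<open>Column spaces of weighted partition matrices\<close>

text \<open>Constancy of \<open>x / w\<close> on each cell, cross-multiplied so that no division
  occurs and no reference point of the cell has to be chosen.\<close>

definition weighted_space :: "real^'v \<Rightarrow> 'v set set \<Rightarrow> (real^'v::finite) set"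
  where "weighted_space w \<pi> = {x. \<forall>C\<in>\<pi>. \<forall>u\<in>C. \<forall>v\<in>C. x $ u * w $ v = x $ v * w $ u}"

lemma positive_vecD: "positive_vec w \<Longrightarrow> 0 < w $ v"
  by (simp add: positive_vec_def)

lemma partition_on_UNIV_cell:
  assumes "partition_on UNIV \<pi>"
  obtains C where "C \<in> \<pi>" "v \<in> C"
  using assms unfolding partition_on_def by blast

lemma partition_on_cell_nonempty:
  assumes "partition_on A \<pi>" "C \<in> \<pi>"
  obtains u where "u \<in> C"
  using assms unfolding partition_on_def by (cases "C = {}") auto

lemma partition_on_cell_eq:
  assumes "partition_on A \<pi>" "C \<in> \<pi>" "D \<in> \<pi>" "v \<in> C" "v \<in> D"
  shows "C = D"
  using assms unfolding partition_on_def disjoint_def by blast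

text \<open>Since \<open>char_mat\<close> has a column for every subset of the vertices, matrix
  products sum over all sets; only the unique cell containing \<open>v\<close> contributes.\<close>

lemma sum_over_cell:
  fixes f :: "'v::finite set \<Rightarrow> real"
  assumes "partition_on UNIV \<pi>" "C \<in> \<pi>" "v \<in> C"
  shows "(\<Sum>D\<in>UNIV. if D \<in> \<pi> \<and> v \<in> D then f D else 0) = f C"
proof -
  have "(if D \<in> \<pi> \<and> v \<in> D then f D else 0) = (if D = C then f C else 0)" for D
    using partition_on_cell_eq[OF assms(1)] assms(2,3) by auto
  then show ?thesis by simp
qed

lemma diag_mat_mult_nth: "(diag_mat w ** M) $ u $ v = w $ u * M $ u $ v"
proof -
  have "(if u = k then w $ k else 0) * M $ k $ v = (if k = u then w $ u * M $ u $ v else 0)" for k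
    by simp
  then show ?thesis by (simp add: matrix_matrix_mult_def diag_mat_def)
qed

lemma mult_diag_mat_nth: "(M ** diag_mat w) $ u $ v = M $ u $ v * w $ v"
proof -
  have "M $ u $ k * (if k = v then w $ v else 0) = (if k = v then M $ u $ v * w $ v else 0)" for k
    by simp
  then show ?thesis by (simp add: matrix_matrix_mult_def diag_mat_def)
qed

lemma weighted_char_mat_mult_nth:
  assumes "partition_on UNIV \<pi>" "C \<in> \<pi>" "v \<in> C"
  shows "((diag_mat w ** char_mat \<pi>) *v y) $ v = w $ v * y $ C"
proof -
  have "((diag_mat w ** char_mat \<pi>) *v y) $ v
      = (\<Sum>D\<in>UNIV. if D \<in> \<pi> \<and> v \<in> D then w $ v * y $ D else 0)"
    unfolding matrix_vector_mult_def
    by (auto simp: diag_mat_mult_nth char_mat_def intro: sum.cong)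
  also have "\<dots> = w $ v * y $ C"
    by (rule sum_over_cell[OF assms])
  finally show ?thesis .
qed

lemma rng_weighted_char_mat:
  assumes p: "partition_on UNIV \<pi>" and w: "positive_vec w"
  shows "rng (diag_mat w ** char_mat \<pi>) = weighted_space w \<pi>"
proof
  show "rng (diag_mat w ** char_mat \<pi>) \<subseteq> weighted_space w \<pi>"
    unfolding rng_def weighted_space_def
    by (auto simp: weighted_char_mat_mult_nth[OF p])
  show "weighted_space w \<pi> \<subseteq> rng (diag_mat w ** char_mat \<pi>)"
  proof
    fix x assume x: "x \<in> weighted_space w \<pi>"
    \<comment> \<open>The coefficient of a cell is the common value of \<open>x / w\<close> on it,
      read off at an arbitrary member. Its value at sets that are not cells is irrelevant, since
      their columns vanish.\<close>
    define y where "y = (\<chi> C. x $ (SOME v. v \<in> C) / w $ (SOME v. v \<in> C))"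
    have "((diag_mat w ** char_mat \<pi>) *v y) $ v = x $ v" for v
    proof -
      obtain C where C: "C \<in> \<pi>" "v \<in> C" using partition_on_UNIV_cell[OF p] .
      let ?u = "SOME v. v \<in> C"
      have "?u \<in> C" using C(2) by (rule someI)
      then have "x $ ?u * w $ v = x $ v * w $ ?u"
        using x C unfolding weighted_space_def by blast
      then show ?thesis
        using positive_vecD[OF w, of ?u]
        by (simp add: weighted_char_mat_mult_nth[OF p C] y_def field_simps)
    qed
    then have "x = (diag_mat w ** char_mat \<pi>) *v y" by (simp add: vec_eq_iff)
    then show "x \<in> rng (diag_mat w ** char_mat \<pi>)" unfolding rng_def by blast
  qed
qed

lemma pseudo_equitable_iff_weighted_space:
  "pseudo_equitable E w \<pi> \<longleftrightarrow> partition_on UNIV \<pi> \<and> positive_vec w \<and>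
    (\<forall>x \<in> weighted_space w \<pi>. adj_mat E *v x \<in> weighted_space w \<pi>)"
  unfolding pseudo_equitable_def by (simp add: rng_weighted_char_mat cong: conj_cong)

lemma subspace_rng: "subspace (rng M)"
  unfolding rng_def by (rule linear_subspace_image[OF matrix_vector_mul_linear subspace_UNIV])

lemma proj_part_weighted_space:
  assumes "partition_on UNIV \<pi>" "positive_vec w"
  shows "proj_part w \<pi> = orth_proj_onto (weighted_space w \<pi>)"
    and "orthogonal_projection (proj_part w \<pi>)"
    and "rng (proj_part w \<pi>) = weighted_space w \<pi>"
  unfolding proj_part_def rng_weighted_char_mat[OF assms, symmetric]
  by (simp_all add: orth_proj_onto subspace_rng)

section \<open>Refinement and joins in terms of weighted spaces\<close>

lemma weighted_space_antimono:
  assumes "refines UNIV \<pi> \<sigma>"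
  shows "weighted_space w \<sigma> \<subseteq> weighted_space w \<pi>"
  using assms unfolding refines_def weighted_space_def by blast

lemma weighted_space_subset_iff_refines:
  assumes p: "partition_on UNIV \<pi>" and s: "partition_on UNIV \<sigma>" and w: "positive_vec w"
  shows "weighted_space w \<sigma> \<subseteq> weighted_space w \<pi> \<longleftrightarrow> refines UNIV \<pi> \<sigma>"
proof
  assume sub: "weighted_space w \<sigma> \<subseteq> weighted_space w \<pi>"
  have "\<exists>C\<in>\<sigma>. D \<subseteq> C" if D: "D \<in> \<pi>" for D
  proof -
    obtain u where u: "u \<in> D" using partition_on_cell_nonempty[OF p D] .
    obtain C where C: "C \<in> \<sigma>" "u \<in> C" using partition_on_UNIV_cell[OF s] .
    \<comment> \<open>The ratio \<open>x / w\<close> is 1 on \<open>C\<close> and 0 on every other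
      cell of \<open>\<sigma>\<close>. Constancy on \<open>D\<close>, which meets \<open>C\<close>
      in \<open>u\<close>, then forces the ratio 1 on all of \<open>D\<close>.\<close>
    define x where "x = (\<chi> v. if v \<in> C then w $ v else 0)"
    have "x \<in> weighted_space w \<sigma>"
      unfolding weighted_space_def x_def using partition_on_cell_eq[OF s C(1)] by auto
    then have "x \<in> weighted_space w \<pi>" using sub by blast
    then have "x $ u * w $ v = x $ v * w $ u" if "v \<in> D" for v
      using D u that unfolding weighted_space_def by blast
    then have "v \<in> C" if "v \<in> D" for v
      using that C(2) positive_vecD[OF w, of u] positive_vecD[OF w, of v]
      by (fastforce simp: x_def split: if_splits)
    then show ?thesis using C(1) by blast
  qed
  then show "refines UNIV \<pi> \<sigma>" unfolding refines_def using p s by blast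
qed (rule weighted_space_antimono)

lemma partition_on_level_sets: "partition_on UNIV ((\<lambda>c. f -` {c}) ` range f)"
  by (rule partition_onI) (auto simp: disjnt_def)

text \<open>For \<open>x\<close> in the intersection, the level sets of \<open>x / w\<close> form a
  common coarsening of \<open>\<pi>\<close> and \<open>\<sigma>\<close>. Leastness of the join makes
  \<open>\<tau>\<close> refine it, so \<open>x / w\<close> is constant on the cells of
  \<open>\<tau>\<close>.\<close>

lemma weighted_space_join:
  assumes j: "is_part_join \<pi> \<sigma> \<tau>" and w: "positive_vec w"
  shows "weighted_space w \<tau> = weighted_space w \<pi> \<inter> weighted_space w \<sigma>"
proof
  show "weighted_space w \<tau> \<subseteq> weighted_space w \<pi> \<inter> weighted_space w \<sigma>"
    using j weighted_space_antimono unfolding is_part_join_def by blast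
  show "weighted_space w \<pi> \<inter> weighted_space w \<sigma> \<subseteq> weighted_space w \<tau>"
  proof
    fix x assume x: "x \<in> weighted_space w \<pi> \<inter> weighted_space w \<sigma>"
    define f where "f v = x $ v / w $ v" for v
    let ?\<rho> = "(\<lambda>c. f -` {c}) ` range f"
    have f_eq: "f u = f v \<longleftrightarrow> x $ u * w $ v = x $ v * w $ u" for u v
      using positive_vecD[OF w, of u] positive_vecD[OF w, of v] by (simp add: f_def field_simps)
    have ref: "refines UNIV \<alpha> ?\<rho>" if \<alpha>: "partition_on UNIV \<alpha>" "x \<in> weighted_space w \<alpha>" for \<alpha>
      unfolding refines_def
    proof (intro conjI ballI \<alpha>(1) partition_on_level_sets)
      fix C assume C: "C \<in> \<alpha>"
      obtain u where u: "u \<in> C" using partition_on_cell_nonempty[OF \<alpha>(1) C] .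
      have "f v = f u" if "v \<in> C" for v
        using \<alpha>(2) C u that unfolding weighted_space_def f_eq by blast
      then show "\<exists>D\<in>?\<rho>. C \<subseteq> D" by blast
    qed
    have "refines UNIV \<tau> ?\<rho>"
      using j x ref unfolding is_part_join_def by (metis IntE refines_def)
    moreover have "x \<in> weighted_space w ?\<rho>"
      unfolding weighted_space_def by (auto simp flip: f_eq)
    ultimately show "x \<in> weighted_space w \<tau>" using weighted_space_antimono by blast
  qed
qed

section \<open>Orthogonal projections and the Loewner order\<close>

lemma orthogonal_projection_sym:
  assumes "orthogonal_projection S"
  shows "S $ u $ v = S $ v $ u"
proof -
  have "S $ u $ v = transpose S $ v $ u" by (simp add: transpose_def)
  then show ?thesis using assms by (simp add: orthogonal_projection_def)
qed

text \<open>Symmetry moves one factor \<open>S\<close> across the inner product and idempotence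
  absorbs it. In particular the quadratic form of a projection is nonnegative.\<close>

lemma orthogonal_projection_inner:
  assumes "orthogonal_projection S"
  shows "x \<bullet> (S *v x) = (S *v x) \<bullet> (S *v x)"
proof -
  have "(S *v x) \<bullet> (S *v x) = (transpose S *v x) \<bullet> (S *v x)"
    using assms by (simp add: orthogonal_projection_def)
  also have "\<dots> = x \<bullet> (S *v (S *v x))"
    by (simp only: transpose_matrix_vector dot_lmul_matrix)
  finally show ?thesis
    using assms by (simp add: matrix_vector_mul_assoc orthogonal_projection_def)
qed

lemma orthogonal_projection_fixes:
  assumes "orthogonal_projection S" "x \<in> rng S"
  shows "S *v x = x"
  using assms unfolding orthogonal_projection_def rng_def
  by (auto simp: matrix_vector_mul_assoc)

text \<open>If \<open>T\<close> fixes \<open>x\<close>, the Loewner inequality bounds the squared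
  norm of \<open>x\<close> by that of \<open>S *v x\<close>; as \<open>S\<close> is a projection,
  the squared norm of \<open>S *v x - x\<close> is then at most 0. Conversely, inclusion of the
  ranges gives \<open>S ** T = T\<close> and \<open>T ** S = T\<close>, which makes
  \<open>S - T\<close> a projection and hence positive semidefinite.\<close>

lemma loewner_ge_iff_rng:
  fixes S T :: "real^'v^'v::finite"
  assumes S: "orthogonal_projection S" and T: "orthogonal_projection T"
  shows "loewner_ge S T \<longleftrightarrow> rng T \<subseteq> rng S"
proof
  assume ge: "loewner_ge S T"
  show "rng T \<subseteq> rng S"
  proof
    fix x assume "x \<in> rng T"
    then have Tx: "T *v x = x" by (rule orthogonal_projection_fixes[OF T])
    have "0 \<le> x \<bullet> ((S - T) *v x)" using ge unfolding loewner_ge_def psd_def by blast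
    then have "x \<bullet> x \<le> x \<bullet> (S *v x)"
      by (simp add: matrix_vector_mult_diff_rdistrib inner_diff_right Tx)
    then have "(S *v x - x) \<bullet> (S *v x - x) \<le> 0"
      using orthogonal_projection_inner[OF S, of x]
      by (simp add: inner_diff_left inner_diff_right inner_commute)
    then have "S *v x = x" by (metis antisym inner_eq_zero_iff inner_ge_zero right_minus_eq)
    then show "x \<in> rng S" unfolding rng_def by (metis rangeI)
  qed
next
  assume sub: "rng T \<subseteq> rng S"
  have "S *v (T *v x) = T *v x" for x
    by (rule orthogonal_projection_fixes[OF S]) (use sub in \<open>auto simp: rng_def\<close>)
  then have ST: "S ** T = T" by (simp add: matrix_eq flip: matrix_vector_mul_assoc)
  then have TS: "T ** S = T"
    using S T unfolding orthogonal_projection_def by (metis matrix_transpose_mul)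
  have tr: "transpose (S - T) = S - T"
    using S T by (simp add: orthogonal_projection_def transpose_def vec_eq_iff)
  have SS: "S ** S = S" "T ** T = T" using S T by (auto simp: orthogonal_projection_def)
  have "(S - T) *v ((S - T) *v x) = (S - T) *v x" for x
    by (simp only: matrix_vector_mult_diff_rdistrib matrix_vector_mult_diff_distrib)
       (simp add: matrix_vector_mul_assoc ST TS SS)
  then have "orthogonal_projection (S - T)"
    by (simp add: orthogonal_projection_def tr matrix_eq flip: matrix_vector_mul_assoc)
  then show "loewner_ge S T"
    using orthogonal_projection_inner unfolding loewner_ge_def psd_def
    by (metis inner_ge_zero tr)
qed

section \<open>The map \<open>phi\<close>: values in \<open>proj_set\<close> and injectivity\<close>

lemma phi_nth:
  assumes p: "partition_on UNIV \<pi>" and C: "C \<in> \<pi>" "u \<in> C"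
  shows "phi (w, \<pi>) $ u $ v = (if v \<in> C then w $ u * w $ v else 0)"
proof -
  have "(char_mat \<pi> ** transpose (char_mat \<pi>)) $ u $ v
      = (\<Sum>D\<in>UNIV. if D \<in> \<pi> \<and> u \<in> D then if v \<in> D then 1 else 0 else (0::real))"
    unfolding matrix_matrix_mult_def
    by (simp add: char_mat_def transpose_def) (rule sum.cong, auto)
  also have "\<dots> = (if v \<in> C then 1 else 0)"
    by (rule sum_over_cell[OF assms])
  finally show ?thesis
    unfolding phi_def
    by (simp add: mult_diag_mat_nth diag_mat_mult_nth matrix_mul_assoc[symmetric, of "diag_mat w"])
qed

lemma phi_mult_nth:
  assumes "partition_on UNIV \<pi>" "C \<in> \<pi>" "u \<in> C"
  shows "(phi (w, \<pi>) *v x) $ u = w $ u * (\<Sum>v\<in>C. w $ v * x $ v)"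
proof -
  have "(phi (w, \<pi>) *v x) $ u = (\<Sum>v\<in>UNIV. if v \<in> C then w $ u * (w $ v * x $ v) else 0)"
    unfolding matrix_vector_mult_def by (auto simp: phi_nth[OF assms] intro: sum.cong)
  then show ?thesis by (simp add: sum.If_cases sum_distrib_left)
qed

text \<open>Squaring the norm turns normalization into the sums that arise from
  \<open>phi_mult_nth\<close>.\<close>

lemma cell_normalized_iff:
  "cell_normalized w \<pi> \<longleftrightarrow> (\<forall>C\<in>\<pi>. (\<Sum>v\<in>C. w $ v * w $ v) = 1)"
proof -
  have "(norm (\<chi> v. if v \<in> C then w $ v else 0))\<^sup>2 = (\<Sum>v\<in>C. w $ v * w $ v)" for C
  proof -
    have "(norm (\<chi> v. if v \<in> C then w $ v else 0))\<^sup>2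
        = (\<Sum>v\<in>UNIV. if v \<in> C then w $ v * w $ v else 0)"
      unfolding power2_norm_eq_inner inner_vec_def by (auto intro: sum.cong)
    then show ?thesis by (simp add: sum.If_cases)
  qed
  moreover have "n = 1 \<longleftrightarrow> n\<^sup>2 = 1" if "0 \<le> n" for n :: real
    using that by (auto simp: power2_eq_1_iff)
  ultimately show ?thesis unfolding cell_normalized_def by simp
qed

text \<open>Every value of \<open>phi (w, \<pi>)\<close> lies in the weighted space, and every
  vector there is fixed; this yields both the range and idempotence.\<close>

lemma phi_orthogonal_projection:
  assumes p: "partition_on UNIV \<pi>" and w: "positive_vec w" and n: "cell_normalized w \<pi>"
  shows "orthogonal_projection (phi (w, \<pi>))" and "rng (phi (w, \<pi>)) = weighted_space w \<pi>"
proof -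
  let ?S = "phi (w, \<pi>)"
  have inW: "?S *v x \<in> weighted_space w \<pi>" for x
    unfolding weighted_space_def by (auto simp: phi_mult_nth[OF p])
  have fixW: "?S *v x = x" if x: "x \<in> weighted_space w \<pi>" for x
    unfolding vec_eq_iff
  proof
    fix u
    obtain C where C: "C \<in> \<pi>" "u \<in> C" using partition_on_UNIV_cell[OF p] .
    have "(?S *v x) $ u = (\<Sum>v\<in>C. x $ v * w $ u * w $ v)"
      by (simp add: phi_mult_nth[OF p C] sum_distrib_left ac_simps)
    \<comment> \<open>Membership in the weighted space exchanges the indices of \<open>x\<close> and
      \<open>w\<close>, so that \<open>x $ u\<close> factors out and normalization evaluates the
      remaining sum to 1.\<close>
    also have "\<dots> = (\<Sum>v\<in>C. x $ u * w $ v * w $ v)"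
      using x C unfolding weighted_space_def by (intro sum.cong) auto
    also have "\<dots> = x $ u"
      using n C(1) by (simp add: cell_normalized_iff mult.assoc flip: sum_distrib_left)
    finally show "(?S *v x) $ u = x $ u" .
  qed
  show "rng ?S = weighted_space w \<pi>"
    unfolding rng_def using inW fixW by (auto simp: image_iff) metis
  have "?S $ u $ v = ?S $ v $ u" for u v
  proof -
    obtain C D where C: "C \<in> \<pi>" "u \<in> C" and D: "D \<in> \<pi>" "v \<in> D"
      using partition_on_UNIV_cell[OF p] by metis
    have "v \<in> C \<longleftrightarrow> u \<in> D" using partition_on_cell_eq[OF p C(1) D(1)] C D by blast
    then show ?thesis by (simp add: phi_nth[OF p C] phi_nth[OF p D])
  qed
  then have "transpose ?S = ?S" by (simp add: transpose_def vec_eq_iff)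
  moreover have "?S ** ?S = ?S"
    by (simp add: matrix_eq inW fixW flip: matrix_vector_mul_assoc)
  ultimately show "orthogonal_projection ?S" unfolding orthogonal_projection_def by blast
qed

text \<open>Invariance of the range says \<open>S ** (A ** S) = A ** S\<close>. The left side is
  symmetric, so transposing the right side gives \<open>S ** A = A ** S\<close>.\<close>

lemma orthogonal_projection_commute_iff:
  fixes A S :: "real^'v^'v::finite"
  assumes S: "orthogonal_projection S" and A: "transpose A = A"
  shows "S ** A = A ** S \<longleftrightarrow> (\<forall>x\<in>rng S. A *v x \<in> rng S)"
proof
  assume c: "S ** A = A ** S"
  show "\<forall>x\<in>rng S. A *v x \<in> rng S"
    unfolding rng_def
    by (auto simp: matrix_vector_mul_assoc c[symmetric]) (metis matrix_vector_mul_assoc rangeI)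
next
  assume inv: "\<forall>x\<in>rng S. A *v x \<in> rng S"
  have "S *v (A *v (S *v x)) = A *v (S *v x)" for x
    by (rule orthogonal_projection_fixes[OF S]) (use inv in \<open>auto simp: rng_def\<close>)
  then have *: "S ** (A ** S) = A ** S" by (simp add: matrix_eq flip: matrix_vector_mul_assoc)
  have "transpose (A ** S) = S ** A"
    using S A by (simp add: matrix_transpose_mul orthogonal_projection_def)
  moreover have "transpose (S ** (A ** S)) = S ** (A ** S)"
    using S A by (simp add: matrix_transpose_mul orthogonal_projection_def matrix_mul_assoc)
  ultimately show "S ** A = A ** S" using * by simp
qed

lemma transpose_adj_mat: "simple_graph E \<Longrightarrow> transpose (adj_mat E) = adj_mat E"
  unfolding simple_graph_def adj_mat_def transpose_def
  by (auto simp: vec_eq_iff dest: sympD)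

lemma phi_in_proj_set:
  assumes "simple_graph E" "(w, \<pi>) \<in> Pi_hat E"
  shows "phi (w, \<pi>) \<in> proj_set E"
proof -
  have p: "partition_on UNIV \<pi>" and w: "positive_vec w" and n: "cell_normalized w \<pi>"
    and inv: "\<forall>x \<in> weighted_space w \<pi>. adj_mat E *v x \<in> weighted_space w \<pi>"
    using assms(2) by (auto simp: Pi_hat_def pseudo_equitable_iff_weighted_space)
  note proj = phi_orthogonal_projection[OF p w n]
  have "0 \<le> phi (w, \<pi>) $ u $ v" for u v
  proof -
    obtain C where C: "C \<in> \<pi>" "u \<in> C" using partition_on_UNIV_cell[OF p] .
    show ?thesis
      using positive_vecD[OF w, of u] positive_vecD[OF w, of v] by (simp add: phi_nth[OF p C])
  qed
  \<comment> \<open>The vector \<open>w\<close> itself serves as the positive vector in the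
    range.\<close>
  moreover have "w \<in> rng (phi (w, \<pi>))"
    by (simp add: proj(2) weighted_space_def mult.commute)
  moreover have "phi (w, \<pi>) ** adj_mat E = adj_mat E ** phi (w, \<pi>)"
    using orthogonal_projection_commute_iff[OF proj(1) transpose_adj_mat[OF assms(1)]] inv proj(2)
    by simp
  ultimately show ?thesis unfolding proj_set_def using proj(1) w by blast
qed

text \<open>The diagonal holds the squares of the entries of \<open>w\<close>, which positivity
  allows to be undone; the support of a row is the cell of its index.\<close>

lemma inj_on_phi: "inj_on phi (Pi_hat E)"
proof (rule inj_onI, clarify)
  fix w \<pi> w' \<pi>'
  assume "(w, \<pi>) \<in> Pi_hat E" "(w', \<pi>') \<in> Pi_hat E" and eq: "phi (w, \<pi>) = phi (w', \<pi>')"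
  then have p: "partition_on UNIV \<pi>" "partition_on UNIV \<pi>'"
    and w: "positive_vec w" "positive_vec w'"
    by (auto simp: Pi_hat_def pseudo_equitable_def)
  have diag: "phi (w, \<pi>) $ u $ u = w $ u * w $ u" if "partition_on UNIV \<pi>"
    for w :: "real^'a" and \<pi> u
    using that by (metis partition_on_UNIV_cell phi_nth)
  have "w $ u = w' $ u" for u
    using diag[OF p(1), of w u] diag[OF p(2), of w' u] eq
      positive_vecD[OF w(1), of u] positive_vecD[OF w(2), of u]
    by (simp add: square_eq_iff)
  then have "w = w'" by (simp add: vec_eq_iff)
  have cell: "{v. phi (w, \<pi>) $ u $ v \<noteq> 0} = C"
    if "partition_on UNIV \<pi>" "positive_vec w" "C \<in> \<pi>" "u \<in> C" for w :: "real^'a" and \<pi> u C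
    using positive_vecD[OF that(2)] by (auto simp: phi_nth[OF that(1,3,4)] less_le)
  have sub: "\<alpha> \<subseteq> \<beta>"
    if \<alpha>: "partition_on UNIV \<alpha>" and \<beta>: "partition_on UNIV \<beta>"
      and eq: "phi (w, \<alpha>) = phi (w, \<beta>)" for \<alpha> \<beta>
  proof
    fix C assume C: "C \<in> \<alpha>"
    obtain u where u: "u \<in> C" using partition_on_cell_nonempty[OF \<alpha> C] .
    obtain D where D: "D \<in> \<beta>" "u \<in> D" using partition_on_UNIV_cell[OF \<beta>] .
    have "C = D" using cell[OF \<alpha> w(1) C u] cell[OF \<beta> w(1) D] eq by simp
    then show "C \<in> \<beta>" using D(1) by simp
  qed
  show "w = w' \<and> \<pi> = \<pi>'"
    using sub[OF p] sub[OF p(2,1)] eq \<open>w = w'\<close> by auto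
qed

section \<open>Block structure of nonnegative projections and surjectivity\<close>

text \<open>A diagonal entry is the sum of squares of its row. Were it not positive, the row would
  vanish, and \<open>S\<close> could not fix a vector that is positive at \<open>u\<close>.\<close>

lemma nonneg_projection_diag_pos:
  fixes S :: "real^'v^'v::finite"
  assumes S: "orthogonal_projection S" and x: "x \<in> rng S" "positive_vec x"
  shows "0 < S $ u $ u"
proof (rule ccontr)
  have sym: "S $ v $ u = S $ u $ v" for v
    by (rule orthogonal_projection_sym[OF S])
  have "S $ u $ u = (S ** S) $ u $ u" using S by (simp add: orthogonal_projection_def)
  also have "\<dots> = (\<Sum>v\<in>UNIV. S $ u $ v * S $ u $ v)"
    by (simp add: matrix_matrix_mult_def sym)
  finally have sq: "S $ u $ u = (\<Sum>v\<in>UNIV. S $ u $ v * S $ u $ v)" .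
  assume "\<not> 0 < S $ u $ u"
  then have "(\<Sum>v\<in>UNIV. S $ u $ v * S $ u $ v) = 0"
    unfolding sq by (intro antisym sum_nonneg) auto
  then have "S $ u $ v = 0" for v
    by (subst (asm) sum_nonneg_eq_0_iff) auto
  then have "(S *v x) $ u = 0" by (simp add: matrix_vector_mult_def)
  then show False
    using orthogonal_projection_fixes[OF S x(1)] positive_vecD[OF x(2), of u] by simp
qed

text \<open>By \<open>S ** S = S\<close> and nonnegativity, the single product through
  \<open>b\<close> is a lower bound for the entry at \<open>a\<close>, \<open>c\<close>.\<close>

lemma nonneg_projection_trans:
  fixes S :: "real^'v^'v::finite"
  assumes S: "orthogonal_projection S" and nn: "\<And>u v. 0 \<le> S $ u $ v"
    and "0 < S $ a $ b" "0 < S $ b $ c"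
  shows "0 < S $ a $ c"
proof -
  have "0 < S $ a $ b * S $ b $ c" using assms(3,4) by simp
  also have "\<dots> \<le> (\<Sum>k\<in>UNIV. S $ a $ k * S $ k $ c)"
    by (rule member_le_sum) (auto simp: nn)
  also have "\<dots> = (S ** S) $ a $ c" by (simp add: matrix_matrix_mult_def)
  finally show ?thesis using S by (simp add: orthogonal_projection_def)
qed

text \<open>This is the maximum argument: on its support, column \<open>v\<close> of
  \<open>S\<close> is proportional to \<open>x\<close>, and the claim compares the entries at
  \<open>u\<close> and \<open>v\<close>.\<close>

lemma nonneg_projection_column:
  fixes S :: "real^'v^'v::finite"
  assumes S: "orthogonal_projection S" and nn: "\<And>u v. 0 \<le> S $ u $ v"
    and x: "x \<in> rng S" "positive_vec x" and uv: "0 < S $ u $ v"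
  shows "S $ u $ v * x $ v = S $ v $ v * x $ u"
proof -
  have sym: "S $ a $ b = S $ b $ a" for a b
    by (rule orthogonal_projection_sym[OF S])
  define K where "K = {k. 0 < S $ k $ v}"
  have v: "v \<in> K" using nonneg_projection_diag_pos[OF S x] by (simp add: K_def)
  define f where "f k = S $ k $ v / x $ k" for k
  have "Max (f ` K) \<in> f ` K" using v by (intro Max_in) auto
  then obtain m where m: "m \<in> K" "f m = Max (f ` K)" by auto
  have le: "f k \<le> f m" if "k \<in> K" for k
    unfolding m(2) using that by (intro Max_ge) auto
  \<comment> \<open>Both \<open>x\<close> and the column \<open>S *v axis v 1\<close> lie in the
    range, so \<open>S\<close> fixes \<open>z\<close>. The choice of \<open>m\<close> makes
    \<open>z\<close> vanish at \<open>m\<close> and nonnegative on \<open>K\<close>.\<close>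
  define z where "z = f m *\<^sub>R x - S *v axis v 1"
  have z_nth: "z $ k = f m * x $ k - S $ k $ v" for k
    by (simp add: z_def matrix_vector_mult_basis column_def)
  have "S *v z = z"
    unfolding z_def
    by (rule orthogonal_projection_fixes[OF S])
       (intro subspace_diff subspace_scale subspace_rng x(1), simp add: rng_def)
  moreover have "z $ m = 0"
    using positive_vecD[OF x(2), of m] by (simp add: z_nth f_def)
  ultimately have "(\<Sum>k\<in>UNIV. S $ m $ k * z $ k) = 0"
    by (metis (no_types) matrix_vector_mult_def vec_lambda_beta)
  moreover have zpos: "0 \<le> z $ k" if "k \<in> K" for k
    using le[OF that] positive_vecD[OF x(2), of k] by (simp add: z_nth f_def[of k] field_simps)
  \<comment> \<open>Row \<open>m\<close> of \<open>S\<close> vanishes outside \<open>K\<close> by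
    transitivity, so negative entries of \<open>z\<close> there do no harm.\<close>
  have "0 \<le> S $ m $ k * z $ k" for k
  proof (cases "0 < S $ m $ k")
    case True
    then have "k \<in> K"
      using m(1) nonneg_projection_trans[OF S nn, of k m v] by (simp add: K_def sym)
    then show ?thesis using zpos nn by simp
  next
    case False
    then show ?thesis using nn[of m k] by simp
  qed
  ultimately have zero: "S $ m $ k * z $ k = 0" for k
    by (subst (asm) sum_nonneg_eq_0_iff) auto
  \<comment> \<open>Transitivity in the other direction makes row \<open>m\<close> positive on all
    of \<open>K\<close>, so vanishing products force \<open>z\<close> to vanish there.\<close>
  have "z $ k = 0" if "k \<in> K" for k
  proof -
    have "0 < S $ m $ k"
      using that m(1) nonneg_projection_trans[OF S nn, of m v k] by (simp add: K_def sym)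
    then show ?thesis using zero[of k] by simp
  qed
  moreover have "u \<in> K" using uv by (simp add: K_def)
  ultimately have "S $ u $ v = f m * x $ u" "S $ v $ v = f m * x $ v"
    using v by (simp_all add: z_nth)
  then show ?thesis by simp
qed

text \<open>Multiplying the proportionality relations for columns \<open>v\<close> and
  \<open>u\<close> and cancelling \<open>x $ v * x $ u\<close> leaves an identity free of
  \<open>x\<close>. Within a class, \<open>S\<close> thus has the rank-one form required by
  \<open>phi\<close>.\<close>

lemma nonneg_projection_entry:
  fixes S :: "real^'v^'v::finite"
  assumes S: "orthogonal_projection S" and nn: "\<And>u v. 0 \<le> S $ u $ v"
    and x: "x \<in> rng S" "positive_vec x" and uv: "0 < S $ u $ v"
  shows "S $ u $ v = sqrt (S $ u $ u) * sqrt (S $ v $ v)"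
proof -
  have sym: "S $ v $ u = S $ u $ v"
    by (rule orthogonal_projection_sym[OF S])
  have "S $ u $ v * x $ v = S $ v $ v * x $ u" "S $ u $ v * x $ u = S $ u $ u * x $ v"
    using nonneg_projection_column[OF S nn x, of u v] nonneg_projection_column[OF S nn x, of v u]
      uv sym by simp_all
  then have "(S $ u $ v * S $ u $ v) * (x $ v * x $ u)
      = (S $ u $ u * S $ v $ v) * (x $ v * x $ u)"
    by algebra
  then have "S $ u $ v * S $ u $ v = S $ u $ u * S $ v $ v"
    using positive_vecD[OF x(2), of u] positive_vecD[OF x(2), of v] by simp
  then show ?thesis
    using nn[of u v] by (metis real_sqrt_abs2 real_sqrt_mult abs_of_nonneg)
qed

lemma proj_set_subset_phi_image:
  assumes "simple_graph E"
  shows "proj_set E \<subseteq> phi ` Pi_hat E"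
proof
  fix S assume "S \<in> proj_set E"
  then obtain x where S: "orthogonal_projection S" and nn: "\<And>u v. 0 \<le> S $ u $ v"
    and x: "x \<in> rng S" "positive_vec x" and comm: "S ** adj_mat E = adj_mat E ** S"
    unfolding proj_set_def by blast
  have sym: "S $ a $ b = S $ b $ a" for a b
    by (rule orthogonal_projection_sym[OF S])
  define r where "r = {(u, v). 0 < S $ u $ v}"
  have "equiv UNIV r"
  proof (rule equivI)
    show "refl r" using nonneg_projection_diag_pos[OF S x] by (auto simp: r_def refl_on_def)
    show "sym r" by (auto simp: r_def sym_def sym)
    show "trans r" using nonneg_projection_trans[OF S nn] by (auto simp: r_def trans_def)
  qed simp
  define \<pi> where "\<pi> = UNIV // r"
  have p: "partition_on UNIV \<pi>"
    unfolding \<pi>_def by (rule partition_on_quotient[OF \<open>equiv UNIV r\<close>])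
  \<comment> \<open>Any member \<open>u\<close> of a class can replace the representative from which
    the quotient was formed.\<close>
  have mem: "v \<in> C \<longleftrightarrow> 0 < S $ u $ v" if "C \<in> \<pi>" "u \<in> C" for C u v
  proof -
    obtain a where "C = r `` {a}" using \<open>C \<in> \<pi>\<close> unfolding \<pi>_def by (rule quotientE)
    moreover from this have "r `` {a} = r `` {u}"
      using \<open>u \<in> C\<close> equiv_class_eq[OF \<open>equiv UNIV r\<close>] by blast
    ultimately show ?thesis by (simp add: r_def)
  qed
  \<comment> \<open>This choice is forced, because the diagonal of \<open>phi (w, \<pi>)\<close>
    consists of the squares of the entries of \<open>w\<close>.\<close>
  define w where "w = (\<chi> v. sqrt (S $ v $ v))"
  have w: "positive_vec w"
    unfolding positive_vec_def w_def using nonneg_projection_diag_pos[OF S x] by simp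
  have phi_S: "phi (w, \<pi>) = S"
    unfolding vec_eq_iff
  proof (intro allI)
    fix u v
    obtain C where C: "C \<in> \<pi>" "u \<in> C" using partition_on_UNIV_cell[OF p] .
    show "phi (w, \<pi>) $ u $ v = S $ u $ v"
      \<comment> \<open>Outside the class of \<open>u\<close> the entry is not positive, hence 0 by
        nonnegativity; inside it, \<open>nonneg_projection_entry\<close> applies.\<close>
      using mem[OF C, of v] nonneg_projection_entry[OF S nn x, of u v] nn[of u v]
      by (auto simp: phi_nth[OF p C] w_def)
  qed
  have n: "cell_normalized w \<pi>"
    unfolding cell_normalized_iff
  proof
    fix C assume C: "C \<in> \<pi>"
    obtain u where u: "u \<in> C" using partition_on_cell_nonempty[OF p C] .
    \<comment> \<open>The column of \<open>S\<close> at \<open>u\<close> is fixed by \<open>S\<close>; compare its entry at \<open>u\<close>.\<close>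
    have "S *v (S *v axis u 1) = S *v axis u 1"
      using S by (simp add: matrix_vector_mul_assoc orthogonal_projection_def)
    moreover have "(S *v axis u 1) $ v = S $ u $ v" for v
      by (simp add: matrix_vector_mult_basis column_def sym)
    moreover have "S $ u $ v = w $ u * w $ v" if "v \<in> C" for v
      using phi_nth[OF p C u, of w v] that by (simp add: phi_S)
    ultimately have "w $ u * (\<Sum>v\<in>C. w $ v * (w $ u * w $ v)) = w $ u * w $ u"
      using phi_mult_nth[OF p C u, of w "S *v axis u 1"] u
      by (auto simp: phi_S)
    then have "w $ u * w $ u * (\<Sum>v\<in>C. w $ v * w $ v) = w $ u * w $ u"
      by (simp add: sum_distrib_left ac_simps)
    then show "(\<Sum>v\<in>C. w $ v * w $ v) = 1"
      using positive_vecD[OF w, of u] by simp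
  qed
  have "\<forall>y \<in> weighted_space w \<pi>. adj_mat E *v y \<in> weighted_space w \<pi>"
    using orthogonal_projection_commute_iff[OF S transpose_adj_mat[OF assms]] comm
      phi_orthogonal_projection(2)[OF p w n] phi_S by simp
  then have "(w, \<pi>) \<in> Pi_hat E"
    using p w n by (simp add: Pi_hat_def pseudo_equitable_iff_weighted_space)
  then show "S \<in> phi ` Pi_hat E" using phi_S by (metis imageI)
qed

theorem theorem15:
  fixes E :: "'v::finite \<Rightarrow> 'v \<Rightarrow> bool"
  assumes "simple_graph E"
  shows "bij_betw phi (Pi_hat E) (proj_set E) \<and>
    (\<forall>w \<pi> \<sigma>. positive_vec w \<and> pseudo_equitable E w \<pi> \<and> pseudo_equitable E w \<sigma> \<longrightarrow>
      ((refines UNIV \<pi> \<sigma> \<longleftrightarrow> loewner_ge (proj_part w \<pi>) (proj_part w \<sigma>)) \<and>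
       (loewner_ge (proj_part w \<pi>) (proj_part w \<sigma>) \<longleftrightarrow>
          rng (proj_part w \<pi>) \<supseteq> rng (proj_part w \<sigma>))) \<and>
      (pseudo_equitable E w (part_join \<pi> \<sigma>) \<and>
       proj_part w (part_join \<pi> \<sigma>) =
          orth_proj_onto (rng (proj_part w \<pi>) \<inter> rng (proj_part w \<sigma>))))"
proof (intro conjI allI impI; (elim conjE)?)
  show "bij_betw phi (Pi_hat E) (proj_set E)"
    unfolding bij_betw_def
    using inj_on_phi phi_in_proj_set[OF assms] proj_set_subset_phi_image[OF assms] by auto
next
  fix w \<pi> \<sigma>
  assume w: "positive_vec w" and pe: "pseudo_equitable E w \<pi>" "pseudo_equitable E w \<sigma>"
  then have p: "partition_on UNIV \<pi>" "partition_on UNIV \<sigma>"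
    by (auto simp: pseudo_equitable_def)
  note \<pi> = proj_part_weighted_space[OF p(1) w] and \<sigma> = proj_part_weighted_space[OF p(2) w]
  have loewner: "loewner_ge (proj_part w \<pi>) (proj_part w \<sigma>) \<longleftrightarrow>
      rng (proj_part w \<sigma>) \<subseteq> rng (proj_part w \<pi>)"
    by (rule loewner_ge_iff_rng[OF \<pi>(2) \<sigma>(2)])
  then show "loewner_ge (proj_part w \<pi>) (proj_part w \<sigma>) \<longleftrightarrow>
      rng (proj_part w \<sigma>) \<subseteq> rng (proj_part w \<pi>)" .
  show "refines UNIV \<pi> \<sigma> \<longleftrightarrow> loewner_ge (proj_part w \<pi>) (proj_part w \<sigma>)"
    unfolding loewner \<pi>(3) \<sigma>(3) weighted_space_subset_iff_refines[OF p w] ..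
  have j: "is_part_join \<pi> \<sigma> (part_join \<pi> \<sigma>)" by (rule part_join[OF p])
  then have pj: "partition_on UNIV (part_join \<pi> \<sigma>)"
    by (auto simp: is_part_join_def refines_def)
  note W = weighted_space_join[OF j w]
  \<comment> \<open>By \<open>W\<close>, the space of the join is the intersection of two invariant
    spaces and hence invariant.\<close>
  show "pseudo_equitable E w (part_join \<pi> \<sigma>)"
    using pe pj w unfolding pseudo_equitable_iff_weighted_space W by blast
  show "proj_part w (part_join \<pi> \<sigma>) =
      orth_proj_onto (rng (proj_part w \<pi>) \<inter> rng (proj_part w \<sigma>))"
    by (simp add: proj_part_weighted_space(1)[OF pj w] W \<pi>(3) \<sigma>(3))
qed

end
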